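(* For every integer $k\geq 2$, the graph $H_{2k-3}$ satisfies $w(H_{2k-3})=2k-1$, $2|L_o(H_{2k-3})|+1=\ell_o(H_{2k-3})=2k+1$, and $\chi(H_{2k-3})=2k$. In particular $w(H_{2k-3})=2|L_o(H_{2k-3})|-1$ but $\chi(H_{2k-3})=2|L_o(H_{2k-3})|=\ell_o(H_{2k-3})-1$.
   Context: For an integer $i\geq 1$, $H_i$ denotes the graph obtained from the disjoint union of the complete graph $K_i$ and the 5-cycle $C_5$ by adding all edges between $K_i$ and $C_5$. $L_o(G)$ denotes the set of all odd integers $m$ such that $G$ contains a cycle of length $m$, and $\ell_o(G)$ the length of a longest odd cycle of a non-bipartite graph $G$. $w(G)$ denotes the clique number (the number of vertices of a largest clique) and $\chi(G)$ the chromatic number. *)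

theory Defs
  imports Main
begin

record 'a ugraph =
  verts :: "'a set"
  edges :: "'a set set"

definition simple_graph :: "'a ugraph \<Rightarrow> bool" where
  "simple_graph G \<longleftrightarrow>
     finite (verts G) \<and> (\<forall>e \<in> edges G. e \<subseteq> verts G \<and> card e = 2)"

definition adjacent :: "'a ugraph \<Rightarrow> 'a \<Rightarrow> 'a \<Rightarrow> bool" where
  "adjacent G u v \<longleftrightarrow> {u, v} \<in> edges G"

definition complete_graph :: "nat \<Rightarrow> nat ugraph" where
  "complete_graph n =
     \<lparr>verts = {..<n}, edges = {{u, v} | u v. u < n \<and> v < n \<and> u \<noteq> v}\<rparr>"

(* A simple graph (and a cycle) only for n >= 3. *)
definition cycle_graph :: "nat \<Rightarrow> nat ugraph" where
  "cycle_graph n =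
     \<lparr>verts = {..<n}, edges = {{u, Suc u mod n} | u. u < n}\<rparr>"

definition disjoint_union :: "'a ugraph \<Rightarrow> 'b ugraph \<Rightarrow> ('a + 'b) ugraph" where
  "disjoint_union G H =
     \<lparr>verts = verts G <+> verts H,
      edges = (\<lambda>e. Inl ` e) ` edges G \<union> (\<lambda>e. Inr ` e) ` edges H\<rparr>"

definition join :: "'a ugraph \<Rightarrow> 'b ugraph \<Rightarrow> ('a + 'b) ugraph" where
  "join G H =
     \<lparr>verts = verts (disjoint_union G H),
      edges = edges (disjoint_union G H)
        \<union> {{Inl u, Inr v} | u v. u \<in> verts G \<and> v \<in> verts H}\<rparr>"

definition H_graph :: "nat \<Rightarrow> (nat + nat) ugraph" where
  "H_graph i = join (complete_graph i) (cycle_graph 5)"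

definition is_clique :: "'a ugraph \<Rightarrow> 'a set \<Rightarrow> bool" where
  "is_clique G C \<longleftrightarrow>
     C \<subseteq> verts G \<and> (\<forall>u \<in> C. \<forall>v \<in> C. u \<noteq> v \<longrightarrow> adjacent G u v)"

definition clique_number :: "'a ugraph \<Rightarrow> nat" where
  "clique_number G = Max {card C | C. is_clique G C}"

definition proper_colouring :: "'a ugraph \<Rightarrow> nat \<Rightarrow> ('a \<Rightarrow> nat) \<Rightarrow> bool" where
  "proper_colouring G n c \<longleftrightarrow>
     (\<forall>v \<in> verts G. c v < n) \<and>
     (\<forall>u \<in> verts G. \<forall>v \<in> verts G. adjacent G u v \<longrightarrow> c u \<noteq> c v)"

definition chromatic_number :: "'a ugraph \<Rightarrow> nat" where
  "chromatic_number G = (LEAST n. \<exists>c. proper_colouring G n c)"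

(* The list enumerates the vertices of the cycle once around; the closing edge
   joins the last entry to the first, so the length of the list is the number
   of edges. The cycle need not be induced. *)
definition is_cycle :: "'a ugraph \<Rightarrow> 'a list \<Rightarrow> bool" where
  "is_cycle G vs \<longleftrightarrow>
     3 \<le> length vs \<and> distinct vs \<and> set vs \<subseteq> verts G \<and>
     (\<forall>j < length vs. adjacent G (vs ! j) (vs ! (Suc j mod length vs)))"

definition odd_cycle_lengths :: "'a ugraph \<Rightarrow> nat set" where
  "odd_cycle_lengths G = {m. odd m \<and> (\<exists>vs. is_cycle G vs \<and> length vs = m)}"

(* Meaningful only if G is finite and has an odd cycle, i.e. is not bipartite. *)
definition longest_odd_cycle_length :: "'a ugraph \<Rightarrow> nat" where
  "longest_odd_cycle_length G = Max (odd_cycle_lengths G)"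

lemma simple_graph_complete_graph: "simple_graph (complete_graph n)"
  by (auto simp: simple_graph_def complete_graph_def)

lemma simple_graph_cycle_graph:
  assumes "3 \<le> n"
  shows "simple_graph (cycle_graph n)"
proof -
  have "u \<noteq> Suc u mod n" if "u < n" for u
    using that assms by (cases "Suc u = n") auto
  then show ?thesis
    using assms by (auto simp: simple_graph_def cycle_graph_def)
qed

lemma simple_graph_join:
  assumes "simple_graph G" and "simple_graph H"
  shows "simple_graph (join G H)"
  using assms
  by (fastforce simp: simple_graph_def join_def disjoint_union_def card_image)

lemma simple_graph_H_graph: "simple_graph (H_graph i)"
  by (simp add: H_graph_def simple_graph_join simple_graph_complete_graph
      simple_graph_cycle_graph)

end

theory Submission
  imports Defs
begin

text \<open>
  Clique number and chromatic number are additive over joins, so for \<open>H_i = K_i + C_5\<close> they equal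
  \<open>i + 2\<close> and \<open>i + 3\<close>. A path on four vertices of \<open>C_5\<close> closes up through any positive number
  of vertices of \<open>K_i\<close> and \<open>H_i\<close> contains a triangle, so every odd length from
  \<open>3\<close> to \<open>i + 4\<close> occurs; for odd \<open>i\<close> the order \<open>i + 5\<close> is even, so no longer odd
  cycle fits.
\<close>

section \<open>Vertices and adjacency in joins\<close>

lemma verts_join [simp]: "verts (join G H) = verts G <+> verts H"
  by (simp add: join_def disjoint_union_def)

lemma ball_Plus_iff: "(\<forall>x \<in> A <+> B. P x) \<longleftrightarrow> (\<forall>a \<in> A. P (Inl a)) \<and> (\<forall>b \<in> B. P (Inr b))"
  by (auto simp: Plus_def)

lemma Plus_subset_Plus_iff: "A <+> B \<subseteq> C <+> D \<longleftrightarrow> A \<subseteq> C \<and> B \<subseteq> D"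
  by (auto simp: Plus_def)

text \<open>Edges of a join inside one side are images of edges under an injection; injectivity
  pulls such an edge back to the original graph.\<close>

lemma Inl_pair_image_iff: "{Inl u, Inl v} = Inl ` e \<longleftrightarrow> {u, v} = e"
  using inj_image_eq_iff[OF inj_Inl, of "{u, v}" e] by simp

lemma Inr_pair_image_iff: "{Inr u, Inr v} = Inr ` e \<longleftrightarrow> {u, v} = e"
  using inj_image_eq_iff[OF inj_Inr, of "{u, v}" e] by simp

lemma adjacent_join_Inl_Inl [simp]: "adjacent (join G H) (Inl u) (Inl v) \<longleftrightarrow> adjacent G u v"
proof -
  have "{Inl u, Inl v} \<noteq> Inr ` e" for e :: "'b set"
    by blast
  then show ?thesis
    by (auto simp: adjacent_def join_def disjoint_union_def image_iff Inl_pair_image_iff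
        doubleton_eq_iff)
qed

lemma adjacent_join_Inr_Inr [simp]: "adjacent (join G H) (Inr u) (Inr v) \<longleftrightarrow> adjacent H u v"
proof -
  have "{Inr u, Inr v} \<noteq> Inl ` e" for e :: "'a set"
    by blast
  then show ?thesis
    by (auto simp: adjacent_def join_def disjoint_union_def image_iff Inr_pair_image_iff
        doubleton_eq_iff)
qed

lemma adjacent_join_Inl_Inr [simp]:
  "adjacent (join G H) (Inl u) (Inr v) \<longleftrightarrow> u \<in> verts G \<and> v \<in> verts H"
proof -
  have "{Inl u, Inr v} \<noteq> Inl ` e" "{Inl u, Inr v} \<noteq> Inr ` f" for e :: "'a set" and f :: "'b set"
    by blast+
  then show ?thesis
    by (auto simp: adjacent_def join_def disjoint_union_def image_iff doubleton_eq_iff)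
qed

lemma adjacent_commute: "adjacent G u v \<longleftrightarrow> adjacent G v u"
  by (simp add: adjacent_def insert_commute)

lemma adjacent_join_Inr_Inl [simp]:
  "adjacent (join G H) (Inr v) (Inl u) \<longleftrightarrow> u \<in> verts G \<and> v \<in> verts H"
  by (subst adjacent_commute) simp

section \<open>Cliques and the clique number of a join\<close>

text \<open>All pairs across the two sides are adjacent, so only pairs within one side impose a
  condition.\<close>

lemma is_clique_join_Plus_iff:
  "is_clique (join G H) (A <+> B) \<longleftrightarrow> is_clique G A \<and> is_clique H B"
  unfolding is_clique_def by (auto simp: ball_Plus_iff Plus_subset_Plus_iff)

text \<open>Brings an arbitrary clique of a join into the form that
  \<open>is_clique_join_Plus_iff\<close> can split.\<close>

lemma obtain_Plus:
  obtains A B where "C = A <+> B"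
proof
  show "C = (Inl -` C) <+> (Inr -` C)"
  proof (rule set_eqI)
    fix x show "x \<in> C \<longleftrightarrow> x \<in> (Inl -` C) <+> (Inr -` C)"
      by (cases x) auto
  qed
qed

lemma is_clique_finite: "finite (verts G) \<Longrightarrow> is_clique G C \<Longrightarrow> finite C"
  by (auto simp: is_clique_def dest: finite_subset)

lemma finite_clique_cards:
  assumes "finite (verts G)"
  shows "finite {card C | C. is_clique G C}"
proof (rule finite_subset)
  show "{card C | C. is_clique G C} \<subseteq> card ` Pow (verts G)"
    by (auto simp: is_clique_def)
qed (use assms in simp)

lemma card_le_clique_number:
  assumes "finite (verts G)" "is_clique G C"
  shows "card C \<le> clique_number G"
  unfolding clique_number_def
  using assms by (intro Max_ge finite_clique_cards) blast+

lemma obtain_maximum_clique: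
  assumes "finite (verts G)"
  obtains C where "is_clique G C" "card C = clique_number G"
proof -
  \<comment> \<open>The empty clique makes the set of sizes nonempty, so its \<open>Max\<close> is
    attained.\<close>
  have "is_clique G {}"
    by (simp add: is_clique_def)
  then have "{card C | C. is_clique G C} \<noteq> {}"
    by blast
  with finite_clique_cards[OF assms] have "clique_number G \<in> {card C | C. is_clique G C}"
    unfolding clique_number_def by (rule Max_in)
  then obtain C where "clique_number G = card C" "is_clique G C"
    by blast
  then show ?thesis
    by (intro that[of C]) simp_all
qed

lemma clique_number_eqI:
  assumes "finite (verts G)" "is_clique G C" "card C = n"
    and "\<And>D. is_clique G D \<Longrightarrow> card D \<le> n"
  shows "clique_number G = n"
proof (rule antisym)
  obtain D where "is_clique G D" "card D = clique_number G"
    using obtain_maximum_clique[OF assms(1)] .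
  then show "clique_number G \<le> n"
    using assms(4)[of D] by simp
  show "n \<le> clique_number G"
    using card_le_clique_number[OF assms(1,2)] assms(3) by simp
qed

text \<open>Maximum cliques of the two sides combine to a clique of the join; conversely, each
  clique of the join splits into one clique per side.\<close>

lemma clique_number_join:
  assumes "finite (verts G)" "finite (verts H)"
  shows "clique_number (join G H) = clique_number G + clique_number H"
proof -
  obtain A where A: "is_clique G A" "card A = clique_number G"
    using obtain_maximum_clique[OF assms(1)] .
  obtain B where B: "is_clique H B" "card B = clique_number H"
    using obtain_maximum_clique[OF assms(2)] .
  show ?thesis
  proof (rule clique_number_eqI)
    show "finite (verts (join G H))"
      using assms by simp
    show "is_clique (join G H) (A <+> B)"
      using A B by (simp add: is_clique_join_Plus_iff)
    show "card (A <+> B) = clique_number G + clique_number H"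
      using A B assms by (simp add: card_Plus is_clique_finite)
  next
    fix D assume D: "is_clique (join G H) D"
    obtain A' B' where eq: "D = A' <+> B'"
      by (rule obtain_Plus)
    have "is_clique G A'" "is_clique H B'"
      using D unfolding eq is_clique_join_Plus_iff by simp_all
    then show "card D \<le> clique_number G + clique_number H"
      unfolding eq using assms
      by (simp add: card_Plus is_clique_finite card_le_clique_number add_mono)
  qed
qed

section \<open>Colourings and the chromatic number of a join\<close>

lemma chromatic_number_le: "proper_colouring G n c \<Longrightarrow> chromatic_number G \<le> n"
  unfolding chromatic_number_def by (rule Least_le) blast

text \<open>Renumbering the values of \<open>c\<close> by an initial segment of the naturals gives a
  proper colouring. This serves restrictions of a colouring, whose colours may have gaps.\<close>

lemma chromatic_number_le_card_image:
  assumes "finite (verts G)"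
    and "\<And>u v. u \<in> verts G \<Longrightarrow> v \<in> verts G \<Longrightarrow> adjacent G u v \<Longrightarrow> c u \<noteq> c v"
  shows "chromatic_number G \<le> card (c ` verts G)"
proof -
  obtain h where h: "bij_betw h (c ` verts G) {0..<card (c ` verts G)}"
    using ex_bij_betw_finite_nat assms(1) by blast
  have "proper_colouring G (card (c ` verts G)) (h \<circ> c)"
    unfolding proper_colouring_def
  proof (intro conjI ballI impI)
    fix v assume "v \<in> verts G"
    then show "(h \<circ> c) v < card (c ` verts G)"
      using bij_betw_apply[OF h, of "c v"] by simp
  next
    fix u v assume "u \<in> verts G" "v \<in> verts G" "adjacent G u v"
    then show "(h \<circ> c) u \<noteq> (h \<circ> c) v"
      using assms(2)[of u v] inj_on_eq_iff[OF bij_betw_imp_inj_on[OF h], of "c u" "c v"] by simp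
  qed
  then show ?thesis
    by (rule chromatic_number_le)
qed

lemma obtain_optimal_colouring:
  assumes "simple_graph G"
  obtains c where "proper_colouring G (chromatic_number G) c"
proof -
  have "finite (verts G)"
    using assms by (simp add: simple_graph_def)
  then obtain h where h: "bij_betw h (verts G) {0..<card (verts G)}"
    using ex_bij_betw_finite_nat by blast
  \<comment> \<open>Without loops, giving all vertices distinct colours is proper; hence the
    \<open>LEAST\<close> ranges over a nonempty set and is attained.\<close>
  have "u \<noteq> v" if "adjacent G u v" for u v
    using assms that by (auto simp: simple_graph_def adjacent_def)
  then have "proper_colouring G (card (verts G)) h"
    using bij_betw_apply[OF h] inj_on_eq_iff[OF bij_betw_imp_inj_on[OF h]]
    by (simp add: proper_colouring_def)
  then have "\<exists>n c. proper_colouring G n c"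
    by blast
  then have "\<exists>c. proper_colouring G (chromatic_number G) c"
    unfolding chromatic_number_def by (rule LeastI_ex)
  then show ?thesis
    using that by blast
qed

lemma chromatic_number_join:
  assumes "simple_graph G" "simple_graph H"
  shows "chromatic_number (join G H) = chromatic_number G + chromatic_number H"
proof (rule antisym)
  obtain a where a: "proper_colouring G (chromatic_number G) a"
    using obtain_optimal_colouring[OF assms(1)] .
  obtain b where b: "proper_colouring H (chromatic_number H) b"
    using obtain_optimal_colouring[OF assms(2)] .
  \<comment> \<open>Shifting the colours of \<open>H\<close> past those of \<open>G\<close>
    separates the two palettes.\<close>
  have "proper_colouring (join G H) (chromatic_number G + chromatic_number H)
      (case_sum a (\<lambda>v. chromatic_number G + b v))"
    using a b by (fastforce simp: proper_colouring_def ball_Plus_iff)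
  then show "chromatic_number (join G H) \<le> chromatic_number G + chromatic_number H"
    by (rule chromatic_number_le)
next
  have fin: "finite (verts G)" "finite (verts H)"
    using assms by (simp_all add: simple_graph_def)
  obtain c where c: "proper_colouring (join G H) (chromatic_number (join G H)) c"
    using obtain_optimal_colouring[OF simple_graph_join[OF assms]] .
  let ?S = "(c \<circ> Inl) ` verts G" and ?T = "(c \<circ> Inr) ` verts H"
  have "chromatic_number G \<le> card ?S" "chromatic_number H \<le> card ?T"
    using c fin by (auto intro!: chromatic_number_le_card_image
        simp: proper_colouring_def ball_Plus_iff)
  \<comment> \<open>A shared colour would occur at both ends of an edge between the two
    sides.\<close>
  moreover have "?S \<inter> ?T = {}"
    using c by (fastforce simp: proper_colouring_def ball_Plus_iff)
  then have "card ?S + card ?T = card (?S \<union> ?T)"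
    using fin by (simp add: card_Un_disjoint)
  moreover have "card (?S \<union> ?T) \<le> card {..<chromatic_number (join G H)}"
    using c by (intro card_mono) (auto simp: proper_colouring_def ball_Plus_iff)
  ultimately show "chromatic_number G + chromatic_number H \<le> chromatic_number (join G H)"
    by simp
qed

section \<open>Complete graphs\<close>

lemma verts_complete_graph [simp]: "verts (complete_graph n) = {..<n}"
  by (simp add: complete_graph_def)

lemma adjacent_complete_graph [simp]:
  "adjacent (complete_graph n) u v \<longleftrightarrow> u < n \<and> v < n \<and> u \<noteq> v"
  by (auto simp: adjacent_def complete_graph_def doubleton_eq_iff)

lemma clique_number_complete_graph: "clique_number (complete_graph n) = n"
proof (rule clique_number_eqI)
  show "is_clique (complete_graph n) {..<n}"
    by (auto simp: is_clique_def)
next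
  fix D assume "is_clique (complete_graph n) D"
  then have "D \<subseteq> {..<n}"
    by (simp add: is_clique_def)
  then show "card D \<le> n"
    using card_mono[OF finite_lessThan] by fastforce
qed auto

lemma chromatic_number_complete_graph: "chromatic_number (complete_graph n) = n"
proof (rule antisym)
  show "chromatic_number (complete_graph n) \<le> n"
    by (rule chromatic_number_le[where c = id]) (auto simp: proper_colouring_def)
  obtain c where "proper_colouring (complete_graph n) (chromatic_number (complete_graph n)) c"
    using obtain_optimal_colouring[OF simple_graph_complete_graph] .
  then have "inj_on c {..<n}" "c ` {..<n} \<subseteq> {..<chromatic_number (complete_graph n)}"
    by (auto simp: proper_colouring_def inj_on_def)
  then show "n \<le> chromatic_number (complete_graph n)"
    using card_inj_on_le[OF _ _ finite_lessThan] by (metis card_lessThan)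
qed

section \<open>The 5-cycle\<close>

lemma verts_cycle_graph [simp]: "verts (cycle_graph n) = {..<n}"
  by (simp add: cycle_graph_def)

lemma adjacent_cycle_graph:
  "adjacent (cycle_graph n) u v \<longleftrightarrow> u < n \<and> v < n \<and> (v = Suc u mod n \<or> u = Suc v mod n)"
  by (auto simp: adjacent_def cycle_graph_def doubleton_eq_iff)

lemma lessThan_5_nat: "{..<5} = {0, 1, 2, 3, 4 :: nat}"
  by auto

lemma cycle_graph_5_triangle_free:
  "\<not> (adjacent (cycle_graph 5) x y \<and> adjacent (cycle_graph 5) y z \<and> adjacent (cycle_graph 5) x z)"
proof -
  have "\<forall>x \<in> {..<5}. \<forall>y \<in> {..<5}. \<forall>z \<in> {..<5}. \<not> (adjacent (cycle_graph 5) x y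
      \<and> adjacent (cycle_graph 5) y z \<and> adjacent (cycle_graph 5) x z)"
    unfolding lessThan_5_nat by (simp add: adjacent_cycle_graph)
  then show ?thesis
    \<comment> \<open>Adjacency already forces both ends below 5, so the finite check covers all
      naturals.\<close>
    by (meson adjacent_cycle_graph lessThan_iff)
qed

lemma clique_number_cycle_graph_5: "clique_number (cycle_graph 5) = 2"
proof (rule clique_number_eqI)
  show "is_clique (cycle_graph 5) {0, 1}"
    by (auto simp: is_clique_def adjacent_cycle_graph)
next
  fix D assume D: "is_clique (cycle_graph 5) D"
  show "card D \<le> 2"
  proof (rule ccontr)
    assume "\<not> card D \<le> 2"
    then have "3 \<le> card D"
      by simp
    then obtain T where "T \<subseteq> D" "card T = 3"
      by (rule obtain_subset_with_card_n)
    then obtain x y z where "x \<in> D" "y \<in> D" "z \<in> D" "x \<noteq> y" "y \<noteq> z" "x \<noteq> z"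
      unfolding card_3_iff by blast
    with D have "adjacent (cycle_graph 5) x y" "adjacent (cycle_graph 5) y z"
      "adjacent (cycle_graph 5) x z"
      unfolding is_clique_def by blast+
    then show False
      using cycle_graph_5_triangle_free by blast
  qed
qed auto

lemma chromatic_number_cycle_graph_5: "chromatic_number (cycle_graph 5) = 3"
proof (rule antisym)
  \<comment> \<open>Colours 0 and 1 alternate along the path from 0 to 3; vertex 4 has neighbours of
    both colours and receives the third.\<close>
  have "proper_colouring (cycle_graph 5) 3 (\<lambda>v. if v = 4 then 2 else v mod 2)"
    by (simp add: proper_colouring_def adjacent_cycle_graph lessThan_5_nat)
  then show "chromatic_number (cycle_graph 5) \<le> 3"
    by (rule chromatic_number_le)
  show "3 \<le> chromatic_number (cycle_graph 5)"
  proof (rule ccontr)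
    assume *: "\<not> 3 \<le> chromatic_number (cycle_graph 5)"
    have "simple_graph (cycle_graph 5)"
      by (simp add: simple_graph_cycle_graph)
    then obtain c where c: "proper_colouring (cycle_graph 5) (chromatic_number (cycle_graph 5)) c"
      by (rule obtain_optimal_colouring)
    have "c v < 2" if "v < 5" for v
    proof -
      have "c v < chromatic_number (cycle_graph 5)"
        using c that by (simp add: proper_colouring_def)
      with * show ?thesis
        by linarith
    qed
    then have "c 0 < 2" "c 1 < 2" "c 2 < 2" "c 3 < 2" "c 4 < 2"
      by simp_all
    moreover have ne: "c v \<noteq> c (Suc v mod 5)" if "v < 5" for v
    proof -
      have "adjacent (cycle_graph 5) v (Suc v mod 5)" "Suc v mod 5 < 5"
        using that by (simp_all add: adjacent_cycle_graph)
      with c that show ?thesis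
        by (simp add: proper_colouring_def)
    qed
    \<comment> \<open>Two colours would have to alternate around the cycle, which its odd length 5
      prevents.\<close>
    have "c 0 \<noteq> c 1" "c 1 \<noteq> c 2" "c 2 \<noteq> c 3" "c 3 \<noteq> c 4" "c 4 \<noteq> c 0"
      using ne[of 0] ne[of 1] ne[of 2] ne[of 3] ne[of 4] by (simp_all add: numeral_2_eq_2)
    ultimately show False
      by linarith
  qed
qed

section \<open>Odd cycles of \<open>H_graph i\<close>\<close>

lemma verts_H_graph [simp]: "verts (H_graph i) = {..<i} <+> {..<5}"
  by (simp add: H_graph_def)

text \<open>Supplies length 3, which the next construction misses since its cycles have length at
  least 5.\<close>

lemma is_cycle_H_graph_triangle:
  assumes "0 < i"
  shows "is_cycle (H_graph i) [Inl 0, Inr 0, Inr 1]"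
  using assms
  by (auto simp: is_cycle_def H_graph_def adjacent_cycle_graph less_Suc_eq)

text \<open>The path 0, 1, 2, 3 of the 5-cycle is followed by \<open>n\<close> vertices of the
  complete graph, all adjacent to both ends of the path. Vertex 4 is left out, so the length is
  \<open>n + 4\<close>.\<close>

lemma is_cycle_H_graph_path:
  assumes "0 < n" "n \<le> i"
  shows "is_cycle (H_graph i) (map Inr [0..<4] @ map Inl [0..<n])"
    (is "is_cycle _ ?vs")
  unfolding is_cycle_def
proof (intro conjI allI impI)
  have Inr: "?vs ! j = Inr j" if "j < 4" for j
    using that by (simp add: nth_append)
  have Inl: "?vs ! j = Inl (j - 4)" if "4 \<le> j" "j < n + 4" for j
    using that by (simp add: nth_append)
  fix j assume "j < length ?vs"
  then have j: "j < n + 4"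
    by simp
  \<comment> \<open>The four kinds of edges: within the path, from the path into the complete graph,
    within the complete graph, and the closing edge back to \<open>Inr 0\<close>.\<close>
  consider "j < 3" | "j = 3" | "4 \<le> j" "Suc j < n + 4" | "4 \<le> j" "Suc j = n + 4"
    using j by linarith
  then have "adjacent (H_graph i) (?vs ! j) (?vs ! (Suc j mod (n + 4)))"
  proof cases
    case 1
    then have "?vs ! (Suc j mod (n + 4)) = Inr (Suc j)"
      by (simp add: Inr)
    with 1 show ?thesis
      by (simp add: Inr H_graph_def adjacent_cycle_graph)
  next
    case 2
    then have "?vs ! (Suc j mod (n + 4)) = Inl 0"
      using assms by (simp add: Inl)
    with 2 assms show ?thesis
      by (simp add: Inr H_graph_def)
  next
    case 3
    then have "?vs ! (Suc j mod (n + 4)) = Inl (Suc j - 4)"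
      by (simp add: Inl)
    with 3 assms show ?thesis
      by (auto simp: Inl H_graph_def)
  next
    case 4
    then have "Suc j mod (n + 4) = 0"
      by (simp only: mod_self)
    then have "?vs ! (Suc j mod (n + 4)) = Inr 0"
      using Inr[of 0] by simp
    with 4 assms show ?thesis
      by (auto simp: Inl H_graph_def)
  qed
  then show "adjacent (H_graph i) (?vs ! j) (?vs ! (Suc j mod length ?vs))"
    by (simp add: add.commute)
qed (use assms in \<open>auto simp: distinct_map\<close>)

lemma is_cycle_length_le:
  assumes "is_cycle G vs" "finite (verts G)"
  shows "length vs \<le> card (verts G)"
  using assms by (metis card_mono distinct_card is_cycle_def)

lemma odd_cycle_lengths_H_graph:
  assumes "odd i"
  shows "odd_cycle_lengths (H_graph i) = {m. odd m \<and> 3 \<le> m \<and> m \<le> i + 4}"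
proof (intro set_eqI iffI)
  fix m assume "m \<in> odd_cycle_lengths (H_graph i)"
  then obtain vs where vs: "odd m" "is_cycle (H_graph i) vs" "length vs = m"
    by (auto simp: odd_cycle_lengths_def)
  then have "m \<le> i + 5"
    using is_cycle_length_le[OF vs(2)] by (simp add: card_Plus)
  \<comment> \<open>Parity excludes a Hamiltonian cycle here: \<open>i + 5\<close> is even while
    \<open>m\<close> is odd.\<close>
  moreover have "m \<noteq> i + 5"
    using vs assms by auto
  ultimately show "m \<in> {m. odd m \<and> 3 \<le> m \<and> m \<le> i + 4}"
    using vs by (auto simp: is_cycle_def)
next
  fix m assume "m \<in> {m. odd m \<and> 3 \<le> m \<and> m \<le> i + 4}"
  then have m: "odd m" "3 \<le> m" "m \<le> i + 4"
    by auto
  have "\<exists>vs. is_cycle (H_graph i) vs \<and> length vs = m"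
  proof (cases "m = 3")
    case True
    then show ?thesis
      using is_cycle_H_graph_triangle[OF odd_pos[OF assms]]
      by (intro exI[of _ "[Inl 0, Inr 0, Inr 1]"]) simp
  next
    case False
    \<comment> \<open>Oddness rules out 4, so \<open>m - 4\<close> is positive and the path
      construction yields length exactly \<open>m\<close>.\<close>
    with m have "m \<noteq> 4" "m > 3"
      by auto
    then have "0 < m - 4" "m - 4 \<le> i"
      using m by auto
    then show ?thesis
      using is_cycle_H_graph_path
      by (intro exI[of _ "map Inr [0..<4] @ map Inl [0..<m - 4]"]) simp
  qed
  with m show "m \<in> odd_cycle_lengths (H_graph i)"
    by (simp add: odd_cycle_lengths_def)
qed

theorem mainTheorem8:
  fixes k :: nat
  assumes "k \<ge> 2"
  defines "G \<equiv> H_graph (2 * k - 3)"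
  shows "clique_number G = 2 * k - 1
    \<and> 2 * card (odd_cycle_lengths G) + 1 = longest_odd_cycle_length G
    \<and> longest_odd_cycle_length G = 2 * k + 1
    \<and> chromatic_number G = 2 * k
    \<and> clique_number G = 2 * card (odd_cycle_lengths G) - 1
    \<and> chromatic_number G = 2 * card (odd_cycle_lengths G)
    \<and> 2 * card (odd_cycle_lengths G) = longest_odd_cycle_length G - 1"
proof -
  have clique: "clique_number G = 2 * k - 1"
    using assms(1)
    by (simp add: G_def H_graph_def clique_number_join clique_number_complete_graph
        clique_number_cycle_graph_5)
  have chromatic: "chromatic_number G = 2 * k"
    using assms(1)
    by (simp add: G_def H_graph_def chromatic_number_join simple_graph_complete_graph
        simple_graph_cycle_graph chromatic_number_complete_graph chromatic_number_cycle_graph_5)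
  \<comment> \<open>The bound on \<open>k\<close> keeps the subtraction from truncating; at
    \<open>k = 1\<close> it would give the even number 0.\<close>
  have "odd (2 * k - 3)"
    using assms(1) by simp
  then have "odd_cycle_lengths G = {m. odd m \<and> 3 \<le> m \<and> m \<le> 2 * k + 1}"
    using assms(1) by (simp add: G_def odd_cycle_lengths_H_graph)
  \<comment> \<open>Indexing the odd lengths by \<open>j\<close> from 1 to \<open>k\<close> exhibits
    both their number \<open>k\<close> and their maximum \<open>2 * k + 1\<close>.\<close>
  also have "\<dots> = (\<lambda>j. 2 * j + 1) ` {1..k}"
    by (auto elim!: oddE)
  finally have lengths: "odd_cycle_lengths G = (\<lambda>j. 2 * j + 1) ` {1..k}" .
  have "card (odd_cycle_lengths G) = k"
    unfolding lengths by (subst card_image) (auto simp: inj_on_def)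
  moreover have "longest_odd_cycle_length G = 2 * k + 1"
    unfolding longest_odd_cycle_length_def lengths
    using assms(1) by (intro Max_eqI) auto
  ultimately show ?thesis
    using clique chromatic by simp
qed

end
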